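(* Consider the Distributed Tracking problem with $k$ players and threshold $N$ under the multinomial arrival model with known probabilities $\mu_1,\dots,\mu_k$, and let $\delta\in(0,1)$. With probability $1-\delta'$, where $\delta'=\delta\cdot O(\log\log N)$, the algorithm $\mathit{DynSlk\text{-}KwnDst}$ (described in the context) runs at most $O\!\left(\log\log\frac{N}{k\log\frac{k}{\delta}}+\log\log\frac{k}{\delta}\right)$ rounds and has total communication cost $O\!\left(k\log\log\frac{N}{k\log\frac{k}{\delta}}+k\log\log\frac{k}{\delta}\right)$.
   Context: Distributed Tracking (DT) problem: a coordinator and $k$ players, each connected to the coordinator by a two-way channel. The coordinator holds a positive integer threshold $N$; player $i\in[k]$ holds a counter $n_i$, initially $0$. Items arrive one at a time; each arriving item increments exactly one player's counter. The coordinator must raise an alarm at exactly the moment the $N$-th item arrives. The communication cost is the total number of messages sent or received by the coordinator, each message carrying $O(1)$ words. Multinomial arrival model: independently for each item, the item arrives at player $i$ with probability $\mu_i$, $\mu_i\ge0$, $\sum_i\mu_i=1$; the $\mu_i$ are known. $\ln$ is the natural logarithm. Straightforward algorithm: each player sends a message for every counter increment. CMY algorithm (in rounds with current threshold $N$): if $N<4k$ run the straightforward algorithm; otherwise send slack $s=\lfloor N/(2k)\rfloor$ to all players, each player notifies whenever its counter has increased by $s$ since its last communication, and on the $k$-th notification the coordinator collects all counters, sets $N\leftarrow N-\sum_in_i$, raises the alarm if $N=0$, else starts a new round. Algorithm $\mathit{DynSlk\text{-}KwnDst}$ runs in rounds; at the start of a round with current threshold $N$ all counters are reset to $0$; if $N\le4k$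 run the straightforward algorithm until termination; else if $N\le\beta k\ln\frac{k}{\delta}$ with $\beta=2(\sqrt2+2/3)^2$ run the CMY algorithm until termination; otherwise set $t=N-(\sqrt2+\frac23)\sqrt{kN\ln\frac{k}{\delta}}$, the coordinator sends to each player $i$ the pair $(b_i,s_i)$ with $b_i=\mu_it$ and $s_i=\lfloor\frac{N-t}{2k}\rfloor$, player $i$ sends its $j$-th notification when $n_i$ reaches $b_i+js_i$ ($j=1,2,\dots$), and upon the $k$-th notification the coordinator collects all counters, sets $N\leftarrow N-\sum_in_i$, raises the alarm and terminates if $N=0$, and otherwise starts a new round. *)

theory Defs
  imports "HOL-Probability.Probability"
begin

section \<open>Arrivals\<close>

text \<open>The players are \<open>1, \<dots>, k\<close>.\<close>

definition prob_vector :: "nat \<Rightarrow> (nat \<Rightarrow> real) \<Rightarrow> bool" where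
  "prob_vector k \<mu> \<longleftrightarrow> (\<forall>i\<in>{1..k}. 0 \<le> \<mu> i) \<and> (\<Sum>i\<in>{1..k}. \<mu> i) = 1"

definition item_pmf :: "nat \<Rightarrow> (nat \<Rightarrow> real) \<Rightarrow> nat pmf" where
  "item_pmf k \<mu> = embed_pmf (\<lambda>i. if i \<in> {1..k} then \<mu> i else 0)"

lemma pmf_item_pmf:
  assumes "prob_vector k \<mu>"
  shows "pmf (item_pmf k \<mu>) i = (if i \<in> {1..k} then \<mu> i else 0)"
  unfolding item_pmf_def
proof (rule pmf_embed_pmf)
  show "0 \<le> (if i \<in> {1..k} then \<mu> i else 0)" for i
    using assms by (auto simp: prob_vector_def)
  have "(\<integral>\<^sup>+ i. ennreal (if i \<in> {1..k} then \<mu> i else 0) \<partial>count_space UNIV)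
      = (\<Sum>i\<in>{1..k}. ennreal (if i \<in> {1..k} then \<mu> i else 0))"
    by (rule nn_integral_count_space') auto
  also have "\<dots> = ennreal (\<Sum>i\<in>{1..k}. \<mu> i)"
    using assms by (subst sum_ennreal[symmetric]) (auto simp: prob_vector_def)
  finally show "(\<integral>\<^sup>+ i. ennreal (if i \<in> {1..k} then \<mu> i else 0) \<partial>count_space UNIV) = 1"
    using assms by (simp add: prob_vector_def)
qed

lemma set_item_pmf:
  assumes "prob_vector k \<mu>"
  shows "set_pmf (item_pmf k \<mu>) \<subseteq> {1..k}"
  using pmf_item_pmf[OF assms] by (auto simp: set_pmf_eq split: if_splits)

text \<open>
  The sequence of players receiving the first \<open>N\<close> items. Later items are irrelevant, because the
  alarm is raised at the \<open>N\<close>-th one (lemma \<open>alarm_run_iff\<close>).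
\<close>

definition arrivals :: "nat \<Rightarrow> (nat \<Rightarrow> real) \<Rightarrow> nat \<Rightarrow> nat list pmf" where
  "arrivals k \<mu> N = replicate_pmf N (item_pmf k \<mu>)"


section \<open>The algorithm\<close>

text \<open>
  A round of \<open>DynSlk\<close> or \<open>CMY\<close> is run with offsets \<open>b\<^sub>i\<close> and slack \<open>s\<close>: player \<open>i\<close> sends its
  \<open>j\<close>-th notification when its counter reaches \<open>b\<^sub>i + j s\<close>. In \<open>CMY\<close> the offsets are \<open>0\<close>, i.e. a
  player notifies whenever its counter has grown by \<open>s\<close> since the start of the round or since its
  last notification. The field \<open>notified\<close> records how many notifications each player has sent in
  the current round. The fields \<open>offset\<close>, \<open>slack\<close>, \<open>notified\<close> are unused in mode
  \<open>Straightforward\<close>.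
\<close>

datatype mode = Straightforward | CMY | DynSlk

record dt_state =
  mode :: mode
  threshold :: nat
  counter :: "nat \<Rightarrow> nat"
  offset :: "nat \<Rightarrow> real"
  slack :: nat
  notified :: "nat \<Rightarrow> nat"
  rounds :: nat
  messages :: nat
  alarm :: bool

text \<open>
  Every round of every mode is counted in \<open>rounds\<close>, including the rounds inside \<open>CMY\<close>; a run of
  the straightforward algorithm counts as one round.
\<close>

definition new_round :: "dt_state \<Rightarrow> dt_state" where
  "new_round S = S\<lparr>counter := (\<lambda>_. 0), notified := (\<lambda>_. 0), rounds := rounds S + 1\<rparr>"

definition start_straightforward :: "dt_state \<Rightarrow> dt_state" where
  "start_straightforward S = (new_round S)\<lparr>mode := Straightforward\<rparr>"

text \<open>One message to each of the \<open>k\<close> players carries the parameters of the round.\<close>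

definition start_slack_round ::
    "nat \<Rightarrow> mode \<Rightarrow> (nat \<Rightarrow> real) \<Rightarrow> nat \<Rightarrow> dt_state \<Rightarrow> dt_state" where
  "start_slack_round k m b s S =
     (new_round S)\<lparr>mode := m, offset := b, slack := s, messages := messages S + k\<rparr>"

definition start_CMY :: "nat \<Rightarrow> dt_state \<Rightarrow> dt_state" where
  "start_CMY k S =
     (if threshold S < 4 * k then start_straightforward S
      else start_slack_round k CMY (\<lambda>_. 0) (threshold S div (2 * k)) S)"

definition dyn_const :: real where
  "dyn_const = sqrt 2 + 2 / 3"

definition dyn_target :: "nat \<Rightarrow> real \<Rightarrow> nat \<Rightarrow> real" where
  "dyn_target k \<delta> N = real N - dyn_const * sqrt (real k * real N * ln (real k / \<delta>))"

definition start_DynSlk :: "nat \<Rightarrow> real \<Rightarrow> (nat \<Rightarrow> real) \<Rightarrow> dt_state \<Rightarrow> dt_state" where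
  "start_DynSlk k \<delta> \<mu> S =
     (let N = threshold S; t = dyn_target k \<delta> N in
      if N \<le> 4 * k then start_straightforward S
      else if real N \<le> 2 * dyn_const\<^sup>2 * real k * ln (real k / \<delta>) then start_CMY k S
      else start_slack_round k DynSlk (\<lambda>i. \<mu> i * t) (nat \<lfloor>(real N - t) / (2 * real k)\<rfloor>) S)"

text \<open>
  Collecting all counters costs \<open>2 * k\<close> messages: a request to and a reply from every player.
\<close>

definition end_round :: "nat \<Rightarrow> real \<Rightarrow> (nat \<Rightarrow> real) \<Rightarrow> dt_state \<Rightarrow> dt_state" where
  "end_round k \<delta> \<mu> S =
     (let S' = S\<lparr>messages := messages S + 2 * k,
                 threshold := threshold S - (\<Sum>p\<in>{1..k}. counter S p)\<rparr> in
      if threshold S' = 0 then S'\<lparr>alarm := True\<rparr>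
      else if mode S' = CMY then start_CMY k S'
      else start_DynSlk k \<delta> \<mu> S')"

text \<open>The effect of one item arriving at player \<open>i\<close>.\<close>

definition arrive :: "nat \<Rightarrow> real \<Rightarrow> (nat \<Rightarrow> real) \<Rightarrow> nat \<Rightarrow> dt_state \<Rightarrow> dt_state" where
  "arrive k \<delta> \<mu> i S =
     (if alarm S then S
      else let S1 = S\<lparr>counter := (counter S)(i := counter S i + 1)\<rparr> in
        if mode S = Straightforward then
          S1\<lparr>messages := messages S + 1, alarm := ((\<Sum>p\<in>{1..k}. counter S1 p) = threshold S)\<rparr>
        else if real (counter S1 i) \<ge> offset S i + real (notified S i + 1) * real (slack S) then
          let S2 = S1\<lparr>notified := (notified S)(i := notified S i + 1),
                      messages := messages S + 1\<rparr> in
            if (\<Sum>p\<in>{1..k}. notified S2 p) = k then end_round k \<delta> \<mu> S2 else S2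
        else S1)"

definition init_state :: "nat \<Rightarrow> dt_state" where
  "init_state N = \<lparr>mode = DynSlk, threshold = N, counter = (\<lambda>_. 0), offset = (\<lambda>_. 0), slack = 0,
     notified = (\<lambda>_. 0), rounds = 0, messages = 0, alarm = False\<rparr>"

definition run :: "nat \<Rightarrow> real \<Rightarrow> (nat \<Rightarrow> real) \<Rightarrow> nat \<Rightarrow> nat list \<Rightarrow> dt_state" where
  "run k \<delta> \<mu> N xs = fold (arrive k \<delta> \<mu>) xs (start_DynSlk k \<delta> \<mu> (init_state N))"


text \<open>The alarm is raised exactly when the \<open>N\<close>-th item arrives.\<close>

definition run_inv :: "nat \<Rightarrow> nat \<Rightarrow> nat \<Rightarrow> dt_state \<Rightarrow> bool" where
  "run_inv k N m S \<longleftrightarrow>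
     \<not> alarm S \<and> m + threshold S = N + (\<Sum>p\<in>{1..k}. counter S p) \<and>
     (if mode S = Straightforward then (\<Sum>p\<in>{1..k}. counter S p) < threshold S
      else (\<forall>p\<in>{1..k}. real (counter S p) < offset S p + real (notified S p + 1) * real (slack S)) \<and>
           (\<Sum>p\<in>{1..k}. notified S p) < k \<and> (1 \<le> slack S \<or> k = 1) \<and>
           (\<Sum>p\<in>{1..k}. offset S p) + 2 * real k * real (slack S) \<le> real (threshold S))"

lemma counter_less_threshold:
  assumes "run_inv k N m S"
  shows "(\<Sum>p\<in>{1..k}. counter S p) < threshold S"
proof (cases "mode S = Straightforward")
  case True
  then show ?thesis using assms by (simp add: run_inv_def)
next
  case False
  let ?s = "real (slack S)"
  have lt: "\<forall>p\<in>{1..k}. real (counter S p) < offset S p + real (notified S p + 1) * ?s"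
    and nk: "(\<Sum>p\<in>{1..k}. notified S p) < k"
    and le: "(\<Sum>p\<in>{1..k}. offset S p) + 2 * real k * ?s \<le> real (threshold S)"
    using assms False by (simp_all add: run_inv_def)
  have "real (\<Sum>p\<in>{1..k}. counter S p) < (\<Sum>p\<in>{1..k}. offset S p + real (notified S p + 1) * ?s)"
    unfolding of_nat_sum using lt nk by (intro sum_strict_mono) auto
  also have "\<dots> = (\<Sum>p\<in>{1..k}. offset S p) + real ((\<Sum>p\<in>{1..k}. notified S p) + k) * ?s"
    by (simp add: sum.distrib distrib_right sum_distrib_right)
  also have "real ((\<Sum>p\<in>{1..k}. notified S p) + k) * ?s \<le> real (2 * k) * ?s"
    using nk by (intro mult_right_mono of_nat_mono) linarith+
  finally have "real (\<Sum>p\<in>{1..k}. counter S p) < real (threshold S)" using le by simp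
  then show ?thesis by (simp only: of_nat_less_iff)
qed

lemma dyn_const_bounds: "2 \<le> dyn_const"
proof -
  have "4 / 3 \<le> sqrt 2"
    by (rule real_le_rsqrt) (simp add: power2_eq_square)
  then show ?thesis by (simp add: dyn_const_def)
qed

lemma DynSlk_round_bounds:
  assumes k: "0 < k" and \<delta>: "0 < \<delta>" "\<delta> < 1"
    and N: "real N > 2 * dyn_const\<^sup>2 * real k * ln (real k / \<delta>)"
  shows "0 < dyn_target k \<delta> N"
    and "dyn_target k \<delta> N \<le> real N"
    and "1 \<le> nat \<lfloor>(real N - dyn_target k \<delta> N) / (2 * real k)\<rfloor> \<or> k = 1"
proof -
  let ?L = "ln (real k / \<delta>)" and ?c = dyn_const
  have c: "2 \<le> ?c" by (rule dyn_const_bounds)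
  have "real k / \<delta> > real k" using k \<delta> by (simp add: field_simps)
  then have kd: "real k / \<delta> > real k" "real k / \<delta> > 1" using k by linarith+
  then have L: "0 < ?L" by simp
  have kL: "0 < real k * ?L" using k L by simp
  have N0: "0 < real N" using N kL c
    by (smt (verit) mult.assoc mult_nonneg_nonneg zero_le_power2)
  let ?r = "sqrt (real k * real N * ?L)"
  have "0 \<le> real k * real N * ?L" using L by simp
  then have "0 \<le> ?c * ?r" using c by (intro mult_nonneg_nonneg) auto
  then show "dyn_target k \<delta> N \<le> real N" by (simp add: dyn_target_def)
  have "?c\<^sup>2 * (real k * ?L) < real N"
  proof -
    have "0 \<le> ?c\<^sup>2 * (real k * ?L)" using kL by simp
    then show ?thesis using N N0 by (simp add: mult.assoc)
  qed
  then have "(?c\<^sup>2 * (real k * ?L)) * real N < real N * real N" using N0 by simp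
  then have "(?c * ?r)\<^sup>2 < (real N)\<^sup>2" using kL N0
    by (simp add: power_mult_distrib power2_eq_square mult_ac)
  then have "?c * ?r < real N" by (rule power2_less_imp_less) simp
  then show "0 < dyn_target k \<delta> N" by (simp add: dyn_target_def)
  show "1 \<le> nat \<lfloor>(real N - dyn_target k \<delta> N) / (2 * real k)\<rfloor> \<or> k = 1"
  proof (cases "k = 1")
    case False
    then have k2: "2 \<le> real k" using k by simp
    have "1 / 2 \<le> ln (2 :: real)" using ln2_ge_two_thirds by simp
    also have "\<dots> \<le> ?L" using kd k2 by simp
    finally have L2: "1 / 2 \<le> ?L" .
    have "(real k * ?L)\<^sup>2 * (2 * ?c\<^sup>2) = (real k * ?L) * (2 * ?c\<^sup>2 * real k * ?L)"
      by (simp add: power2_eq_square mult_ac)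
    also have "\<dots> \<le> (real k * ?L) * real N" using N kL by (intro mult_left_mono) auto
    finally have "(real k * ?L)\<^sup>2 * (2 * ?c\<^sup>2) \<le> real k * real N * ?L" by (simp add: mult_ac)
    moreover have "(real k * ?L)\<^sup>2 * 8 \<le> (real k * ?L)\<^sup>2 * (2 * ?c\<^sup>2)"
      using power_mono[OF c, of 2] by (intro mult_left_mono) auto
    moreover have "(2 * (real k * ?L))\<^sup>2 \<le> (real k * ?L)\<^sup>2 * 8"
      by (simp add: power_mult_distrib)
    ultimately have "(2 * (real k * ?L))\<^sup>2 \<le> real k * real N * ?L" by linarith
    then have "2 * (real k * ?L) \<le> ?r" by (rule real_le_rsqrt)
    moreover have "real k * (1 / 2) \<le> real k * ?L" using L2 k by (intro mult_left_mono) auto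
    ultimately have r: "real k \<le> ?r" by linarith
    have "2 * real k \<le> ?c * ?r" using c r k by (intro mult_mono) auto
    then have "1 \<le> (real N - dyn_target k \<delta> N) / (2 * real k)"
      using k by (simp add: dyn_target_def)
    then have "1 \<le> \<lfloor>(real N - dyn_target k \<delta> N) / (2 * real k)\<rfloor>" by (simp add: le_floor_iff)
    then show ?thesis by linarith
  qed simp
qed

lemma run_inv_start_CMY:
  assumes "0 < k" "\<not> alarm S" "0 < threshold S" "m + threshold S = N"
  shows "run_inv k N m (start_CMY k S)"
proof (cases "threshold S < 4 * k")
  case True
  then show ?thesis using assms
    by (simp add: run_inv_def start_CMY_def start_straightforward_def new_round_def)
next
  case False
  let ?s = "threshold S div (2 * k)"
  have "2 \<le> ?s" using False assms(1) by (simp add: less_eq_div_iff_mult_less_eq)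
  moreover have "2 * k * ?s \<le> threshold S" by simp
  then have "real (2 * k * ?s) \<le> real (threshold S)" by (subst of_nat_le_iff)
  ultimately show ?thesis using assms False
    by (simp add: run_inv_def start_CMY_def start_slack_round_def new_round_def)
qed

lemma run_inv_start_DynSlk:
  assumes k: "0 < k" and \<delta>: "0 < \<delta>" "\<delta> < 1" and \<mu>: "prob_vector k \<mu>"
    and S: "\<not> alarm S" "0 < threshold S" "m + threshold S = N"
  shows "run_inv k N m (start_DynSlk k \<delta> \<mu> S)"
proof -
  let ?N = "threshold S"
  let ?t = "dyn_target k \<delta> ?N"
  let ?s = "nat \<lfloor>(real ?N - ?t) / (2 * real k)\<rfloor>"
  consider (a) "?N \<le> 4 * k"
    | (b) "\<not> ?N \<le> 4 * k" "real ?N \<le> 2 * dyn_const\<^sup>2 * real k * ln (real k / \<delta>)"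
    | (c) "\<not> ?N \<le> 4 * k" "\<not> real ?N \<le> 2 * dyn_const\<^sup>2 * real k * ln (real k / \<delta>)"
    by blast
  then show ?thesis
  proof cases
    case a
    then show ?thesis using S
      by (simp add: run_inv_def start_DynSlk_def start_straightforward_def new_round_def)
  next
    case b
    then show ?thesis using run_inv_start_CMY[OF k S] by (simp add: start_DynSlk_def)
  next
    case c
    then have big: "real ?N > 2 * dyn_const\<^sup>2 * real k * ln (real k / \<delta>)" by simp
    note bounds = DynSlk_round_bounds[OF k \<delta> big]
    have eq: "start_DynSlk k \<delta> \<mu> S = start_slack_round k DynSlk (\<lambda>i. \<mu> i * ?t) ?s S"
      using c by (simp add: start_DynSlk_def Let_def)
    have pos: "0 < \<mu> p * ?t + real ?s" if p: "p \<in> {1..k}" for p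
    proof (cases "1 \<le> ?s")
      case True
      moreover have "0 \<le> \<mu> p * ?t" using \<mu> p bounds(1) by (auto simp: prob_vector_def)
      ultimately show ?thesis by linarith
    next
      case False
      then have "k = 1" using bounds(3) by blast
      then have "\<mu> p = 1" using \<mu> p by (simp add: prob_vector_def)
      then show ?thesis using bounds(1) by simp
    qed
    have sum: "(\<Sum>p\<in>{1..k}. \<mu> p * ?t) = ?t"
      using \<mu> by (simp add: prob_vector_def flip: sum_distrib_right)
    have "real ?s \<le> (real ?N - ?t) / (2 * real k)" using bounds(2) by simp
    then have "2 * real k * real ?s \<le> real ?N - ?t" using k by (simp add: field_simps)
    then have sle: "(\<Sum>p\<in>{1..k}. \<mu> p * ?t) + 2 * real k * real ?s \<le> real ?N" using sum by simp
    show ?thesis unfolding eq run_inv_def start_slack_round_def new_round_def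
      using S k pos sle bounds(3) by simp
  qed
qed

lemma arrive_cases:
  assumes k: "0 < k" and \<delta>: "0 < \<delta>" "\<delta> < 1" and \<mu>: "prob_vector k \<mu>"
    and i: "i \<in> {1..k}" and S: "run_inv k N m S"
  shows "if Suc m = N then alarm (arrive k \<delta> \<mu> i S)
         else run_inv k N (Suc m) (arrive k \<delta> \<mu> i S)"
proof -
  define n where "n = (counter S)(i := counter S i + 1)"
  define c where "c = (notified S)(i := notified S i + 1)"
  have "(\<Sum>p\<in>{1..k}. (f(i := f i + 1)) p) = (\<Sum>p\<in>{1..k}. f p) + 1" for f :: "nat \<Rightarrow> nat"
    using i by (simp add: sum.remove[of _ i])
  from this[of "counter S"] this[of "notified S"]
  have upd: "(\<Sum>p\<in>{1..k}. n p) = (\<Sum>p\<in>{1..k}. counter S p) + 1"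
    "(\<Sum>p\<in>{1..k}. c p) = (\<Sum>p\<in>{1..k}. notified S p) + 1"
    unfolding n_def c_def by blast+
  have lt: "(\<Sum>p\<in>{1..k}. counter S p) < threshold S" by (rule counter_less_threshold[OF S])
  have al: "\<not> alarm S" and m: "m + threshold S = N + (\<Sum>p\<in>{1..k}. counter S p)"
    using S by (simp_all add: run_inv_def)
  have iff: "Suc m = N \<longleftrightarrow> (\<Sum>p\<in>{1..k}. n p) = threshold S"
    unfolding upd using m by linarith
  show ?thesis
  proof (cases "mode S = Straightforward")
    case True
    have "arrive k \<delta> \<mu> i S = S\<lparr>counter := n, messages := messages S + 1,
        alarm := ((\<Sum>p\<in>{1..k}. n p) = threshold S)\<rparr>"
      using True al by (simp add: arrive_def Let_def n_def)
    then show ?thesis using True m lt iff upd(1) by (auto simp: run_inv_def)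
  next
    case False
    let ?s = "real (slack S)"
    have inv: "\<forall>p\<in>{1..k}. real (counter S p) < offset S p + real (notified S p + 1) * ?s"
      "(\<Sum>p\<in>{1..k}. notified S p) < k" "1 \<le> slack S \<or> k = 1"
      "(\<Sum>p\<in>{1..k}. offset S p) + 2 * real k * ?s \<le> real (threshold S)"
      using S False by (simp_all add: run_inv_def)
    consider (quiet) "\<not> real (n i) \<ge> offset S i + real (notified S i + 1) * ?s"
      | (notify) "real (n i) \<ge> offset S i + real (notified S i + 1) * ?s" "(\<Sum>p\<in>{1..k}. c p) \<noteq> k"
      | (finish) "real (n i) \<ge> offset S i + real (notified S i + 1) * ?s" "(\<Sum>p\<in>{1..k}. c p) = k"
      by blast
    then show ?thesis
    proof cases
      case quiet
      let ?S = "S\<lparr>counter := n\<rparr>"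
      have eq: "arrive k \<delta> \<mu> i S = ?S" using quiet al False by (simp add: arrive_def Let_def n_def)
      have "run_inv k N (Suc m) ?S"
        using quiet al False inv m upd(1) by (auto simp: run_inv_def n_def)
      moreover from counter_less_threshold[OF this] have "Suc m \<noteq> N" unfolding iff by simp
      ultimately show ?thesis by (simp add: eq)
    next
      case notify
      let ?S = "S\<lparr>counter := n, notified := c, messages := messages S + 1\<rparr>"
      have eq: "arrive k \<delta> \<mu> i S = ?S" using notify al False
        by (simp add: arrive_def Let_def n_def c_def)
      have ck: "(\<Sum>p\<in>{1..k}. c p) < k" using notify(2) inv(2) unfolding upd by linarith
      then have "k \<noteq> 1" unfolding upd by linarith
      then have s1: "1 \<le> slack S" using inv(3) by blast
      have "real (n p) < offset S p + real (c p + 1) * ?s" if p: "p \<in> {1..k}" for p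
        using inv(1)[rule_format, OF p] s1 by (auto simp: n_def c_def algebra_simps)
      then have "run_inv k N (Suc m) ?S"
        using al False inv m ck s1 upd(1) by (simp add: run_inv_def)
      moreover from counter_less_threshold[OF this] have "Suc m \<noteq> N" unfolding iff by simp
      ultimately show ?thesis by (simp add: eq)
    next
      case finish
      let ?S = "S\<lparr>counter := n, notified := c, messages := messages S + 1\<rparr>"
      let ?E = "?S\<lparr>messages := messages ?S + 2 * k, threshold := threshold S - (\<Sum>p\<in>{1..k}. n p)\<rparr>"
      have eq: "arrive k \<delta> \<mu> i S = end_round k \<delta> \<mu> ?S" using finish al False
        by (simp add: arrive_def Let_def n_def c_def)
      have th: "Suc m + threshold ?E = N" "\<not> alarm ?E"
        using lt m al unfolding upd by simp_all
      have z: "threshold ?E = 0 \<longleftrightarrow> Suc m = N" using th by linarith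
      show ?thesis
      proof (cases "Suc m = N")
        case True
        then show ?thesis using z unfolding eq by (simp add: end_round_def)
      next
        case ne: False
        then have pos: "0 < threshold ?E" using z by linarith
        have "arrive k \<delta> \<mu> i S =
            (if mode ?E = CMY then start_CMY k ?E else start_DynSlk k \<delta> \<mu> ?E)"
          using pos unfolding eq by (simp add: end_round_def Let_def)
        then show ?thesis
          using ne run_inv_start_CMY[OF k th(2) pos th(1)]
            run_inv_start_DynSlk[OF k \<delta> \<mu> th(2) pos th(1)] by (simp)
      qed
    qed
  qed
qed

theorem alarm_run_iff:
  assumes k: "0 < k" and N: "0 < N" and \<delta>: "0 < \<delta>" "\<delta> < 1" and \<mu>: "prob_vector k \<mu>"
    and xs: "set xs \<subseteq> {1..k}"
  shows "alarm (run k \<delta> \<mu> N xs) \<longleftrightarrow> N \<le> length xs"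
proof -
  have "if N \<le> length xs then alarm (run k \<delta> \<mu> N xs)
        else run_inv k N (length xs) (run k \<delta> \<mu> N xs)"
    using xs
  proof (induction xs rule: rev_induct)
    case Nil
    have "run_inv k N 0 (start_DynSlk k \<delta> \<mu> (init_state N))"
      by (rule run_inv_start_DynSlk[OF k \<delta> \<mu>]) (use N in \<open>simp_all add: init_state_def\<close>)
    then show ?case using N by (simp add: run_def)
  next
    case (snoc x xs)
    have eq: "run k \<delta> \<mu> N (xs @ [x]) = arrive k \<delta> \<mu> x (run k \<delta> \<mu> N xs)" by (simp add: run_def)
    show ?case
    proof (cases "N \<le> length xs")
      case True
      then show ?thesis using snoc by (simp add: eq arrive_def)
    next
      case False
      then have "run_inv k N (length xs) (run k \<delta> \<mu> N xs)" using snoc by simp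
      from arrive_cases[OF k \<delta> \<mu> _ this, of x] show ?thesis
        using snoc.prems False by (auto simp: eq split: if_splits)
    qed
  qed
  then show ?thesis by (auto simp: run_inv_def split: if_splits)
qed



section \<open>Iterated logarithm in asymptotic bounds\<close>

text \<open>
  Inside the \<open>O\<close>-bounds, \<open>log log x\<close> is read as \<open>max 1 (ln (ln x))\<close>, also where \<open>ln (ln x)\<close> is
  undefined. The truncation is needed because the arguments can be arbitrarily small here, whereas
  there is always at least one round.
\<close>

definition loglog :: "real \<Rightarrow> real" where
  "loglog x = (if x \<le> exp (exp 1) then 1 else ln (ln x))"

end

theory Submission
  imports Defs
begin

text \<open>
  Write \<open>L = ln (k / \<delta>)\<close> and \<open>r = \<surd>(k N L)\<close> for a \<open>DynSlk\<close> round with threshold \<open>N\<close>. With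
  \<open>\<theta> = (5 / 2) r / N\<close>, each \<open>exp (\<theta> n\<^sub>i - n \<mu>\<^sub>i (\<theta> + \<theta>\<^sup>2))\<close>, where \<open>n = \<Sum>\<^sub>i n\<^sub>i\<close>, is a
  supermartingale starting at \<open>1\<close>. For \<open>k \<ge> 2\<close>, if player \<open>i\<close> has sent a notification although
  \<open>n < t - \<theta> N\<close>, it exceeds \<open>k / \<delta>\<close>. So up to probability \<open>\<delta>\<close> no notification is sent before
  \<open>t - \<theta> N\<close> items have arrived, and the next threshold is at most \<open>5 r\<close>. In units of \<open>k L\<close> the
  threshold then falls from \<open>25 \<cdot> 2\<^bsup>2^(j+1)\<^esup>\<close> to \<open>25 \<cdot> 2\<^bsup>2^j\<^esup>\<close>, so \<open>log log\<close> many good rounds bring it to a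
  constant. From there every round deterministically removes at least \<open>k L\<close> items, and finally
  \<open>CMY\<close> multiplies the threshold by at most \<open>3 / 4\<close> per round.

  The failure probability after \<open>n\<close> further items is bounded by the potential \<open>\<delta> j\<close> plus
  \<open>\<delta> / k\<close> times the sum of the supermartingales of the current round. This potential does not
  increase in expectation with any single item, so no stopping times are needed. For \<open>k = 1\<close> the
  process is deterministic, and the failure term has to be dropped: \<open>N / (k L)\<close> can exceed \<open>N\<close> by
  far, so \<open>\<delta> j\<close> would not be bounded by \<open>\<delta> \<cdot> O(log log N)\<close>.
\<close>

section \<open>Elementary numerical estimates\<close>

lemma dyn_const_le: "dyn_const \<le> 21 / 10"
proof -
  have "sqrt 2 \<le> 43 / 30"
    by (rule real_le_lsqrt) (simp_all add: power2_eq_square)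
  then show ?thesis by (simp add: dyn_const_def)
qed

text \<open>The left side is the moment generating function of a Bernoulli variable with mean
  \<open>p\<close>. The bound makes the supermartingale of a \<open>DynSlk\<close> round work; it
  rests on \<open>exp x \<le> 1 + x + x\<^sup>2\<close> for \<open>x\<close> in the unit
  interval.\<close>

lemma exp_bound_quadratic:
  assumes "0 \<le> (x::real)" "x \<le> 1" "0 \<le> p"
  shows "1 + p * (exp x - 1) \<le> exp (p * (x + x\<^sup>2))"
proof -
  have "1 + p * (exp x - 1) \<le> 1 + p * (x + x\<^sup>2)"
    using exp_bound[OF assms(1,2)] assms(3) by (intro add_left_mono mult_left_mono) auto
  also have "\<dots> \<le> exp (p * (x + x\<^sup>2))" by (rule exp_ge_add_one_self)
  finally show ?thesis .
qed

section \<open>Iterated logarithms\<close>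

lemma loglog_ge_1: "1 \<le> loglog x"
proof (cases "x \<le> exp (exp 1)")
  case False
  then have x: "exp (exp 1) < x" by simp
  then have "0 < x" by (rule less_trans[OF exp_gt_zero])
  then have "exp 1 \<le> ln x" using x by (simp add: ln_ge_iff)
  then have "1 \<le> ln (ln x)"
    by (subst ln_ge_iff) (auto intro: less_le_trans[OF exp_gt_zero])
  then show ?thesis using False by (simp add: loglog_def)
qed (simp add: loglog_def)

text \<open>Above the cutoff this is an equality; below it the truncated value 1 still suffices,
  because there \<open>ln x\<close> is at most \<open>exp 1\<close>.\<close>

lemma ln_le_exp_loglog:
  assumes "0 < x"
  shows "ln x \<le> exp (loglog x)"
proof (cases "x \<le> exp (exp 1)")
  case True
  then have "ln x \<le> exp 1" using assms by (simp add: ln_le_cancel_iff[of x "exp (exp 1)", symmetric])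
  then show ?thesis using True by (simp add: loglog_def)
next
  case False
  then have "exp 1 \<le> ln x" using assms by (simp add: ln_ge_iff)
  then have "0 < ln x" by (rule less_le_trans[OF exp_gt_zero])
  then show ?thesis using False by (simp add: loglog_def)
qed

lemma loglog_mono:
  assumes "x \<le> y"
  shows "loglog x \<le> loglog y"
proof (cases "x \<le> exp (exp 1)")
  case True
  then show ?thesis using loglog_ge_1[of y] by (simp add: loglog_def)
next
  case False
  then have x: "exp (exp 1) < x" by simp
  then have "0 < x" by (rule less_trans[OF exp_gt_zero])
  then have "exp 1 \<le> ln x" using x by (simp add: ln_ge_iff)
  then have "0 < ln x" by (rule less_le_trans[OF exp_gt_zero])
  then show ?thesis using False assms \<open>0 < x\<close> by (simp add: loglog_def)
qed

text \<open>Doubling the exponent gains a factor \<open>exp 1\<close>, since \<open>loglog\<close>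
  is at least 1. That factor absorbs the constants in the two level counts below.\<close>

lemma exp_double_loglog:
  assumes "0 < x" "0 \<le> ln x"
  shows "exp 1 * ln x \<le> exp (2 * loglog x)"
proof -
  have "exp 1 * ln x \<le> exp (loglog x) * exp (loglog x)"
    using loglog_ge_1[of x] ln_le_exp_loglog[OF assms(1)] assms(2) by (intro mult_mono) auto
  then show ?thesis by (simp flip: exp_add)
qed

text \<open>A change of base that also rounds the exponent up to a natural number, so that it can
  count rounds.\<close>

lemma exp_le_power_nat_ceiling:
  fixes B :: real
  assumes "1 \<le> B" "d \<le> c * ln B" "0 \<le> l"
  shows "exp (d * l) \<le> B ^ nat \<lceil>c * l\<rceil>"
proof -
  have "d * l \<le> c * ln B * l" using assms by (intro mult_right_mono)
  also have "\<dots> = (c * l) * ln B" by simp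
  also have "\<dots> \<le> real (nat \<lceil>c * l\<rceil>) * ln B"
    using assms by (intro mult_right_mono) (linarith, simp)
  finally have "exp (d * l) \<le> exp (real (nat \<lceil>c * l\<rceil>) * ln B)" by simp
  also have "\<dots> = B ^ nat \<lceil>c * l\<rceil>" using assms by (simp add: exp_of_nat_mult)
  finally show ?thesis .
qed

text \<open>\<open>J\<close> will count the rounds in which the threshold, in units of
  \<open>k * L\<close>, roughly drops to its square root.\<close>

lemma loglog_levels:
  obtains J :: nat where "x \<le> 2 ^ 2 ^ J" "real J \<le> 4 * loglog x"
proof
  let ?l = "loglog x"
  \<comment> \<open>The factor 3 comes from \<open>2 \<le> 3 * ln 2\<close>; rounding up then costs
    at most one more \<open>?l\<close>.\<close>
  let ?J = "nat \<lceil>3 * ?l\<rceil>"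
  have l: "1 \<le> ?l" by (rule loglog_ge_1)
  then show "real ?J \<le> 4 * ?l" by linarith
  show "x \<le> 2 ^ 2 ^ ?J"
  proof (cases "1 \<le> x")
    case True
    then have x: "0 < x" "0 \<le> ln x" by auto
    have "ln x \<le> (exp 1 * (2 / 3)) * ln x"
      using x exp_ge_add_one_self[of 1] by (intro mult_le_cancel_right1[THEN iffD2]) auto
    also have "\<dots> = exp 1 * ln x * (2 / 3)" by simp
    also have "\<dots> \<le> exp (2 * ?l) * (2 / 3)"
      using exp_double_loglog[OF x] by (intro mult_right_mono) auto
    also have "\<dots> \<le> 2 ^ ?J * ln 2"
      using l ln2_ge_two_thirds by (intro mult_mono exp_le_power_nat_ceiling) auto
    also have "\<dots> = ln (2 ^ 2 ^ ?J)" by (simp add: ln_realpow)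
    finally show ?thesis using x by simp
  next
    case False
    then show ?thesis using one_le_power[of "2::real" "2 ^ ?J"] by linarith
  qed
qed

text \<open>\<open>J\<close> will count the \<open>CMY\<close> rounds: starting from at most
  \<open>9 * k * L\<close>, the threshold has to fall below \<open>4 * k\<close> by factors
  3/4.\<close>

lemma CMY_levels:
  assumes "1 < x"
  obtains J :: nat where "9 * ln x < 4 * (4 / 3) ^ J" "real J \<le> 9 * loglog x"
proof
  let ?l = "loglog x"
  \<comment> \<open>The factor 8 comes from \<open>ln (4 / 3) \<ge> 1 / 4\<close>.\<close>
  let ?J = "nat \<lceil>8 * ?l\<rceil>"
  have l: "1 \<le> ?l" by (rule loglog_ge_1)
  then show "real ?J \<le> 9 * ?l" by linarith
  have "9 * ln x < 4 * exp 1 * ln x"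
  proof (rule mult_strict_right_mono)
    show "9 < 4 * exp (1::real)" using e_approx_32 by (simp add: abs_if split: if_splits)
  qed (use assms in simp)
  also have "\<dots> = 4 * (exp 1 * ln x)" by simp
  also have "\<dots> \<le> 4 * exp (2 * ?l)"
    using assms by (intro mult_left_mono exp_double_loglog) auto
  also have "\<dots> \<le> 4 * (4 / 3) ^ ?J"
  proof (intro mult_left_mono exp_le_power_nat_ceiling)
    have "ln (3 / 4 :: real) \<le> 3 / 4 - 1" by (rule ln_le_minus_one) simp
    moreover have "ln (3 / 4 :: real) = - ln (4 / 3)" by (simp add: ln_div)
    ultimately show "2 \<le> 8 * ln (4 / 3 :: real)" by simp
  qed (use l in auto)
  finally show "9 * ln x < 4 * (4 / 3) ^ ?J" .
qed

lemma sum_fun_upd_Suc: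
  fixes c :: "nat \<Rightarrow> nat"
  assumes "p \<in> {1..k}"
  shows "(\<Sum>i\<in>{1..k}. (c(p := Suc (c p))) i) = Suc (\<Sum>i\<in>{1..k}. c i)"
  using assms by (simp add: sum.remove[of _ p])

section \<open>Messages\<close>

text \<open>A round costs at most \<open>k + k + 2 k\<close> messages.\<close>

definition msg_inv :: "nat \<Rightarrow> dt_state \<Rightarrow> bool" where
  "msg_inv k S \<longleftrightarrow>
     (if alarm S then messages S \<le> 4 * k * rounds S
      else if mode S = Straightforward then
        messages S + 4 * k \<le> 4 * k * rounds S + (\<Sum>p\<in>{1..k}. counter S p) \<and>
        (\<Sum>p\<in>{1..k}. counter S p) < threshold S \<and> threshold S \<le> 4 * k
      else messages S + 3 * k \<le> 4 * k * rounds S + (\<Sum>p\<in>{1..k}. notified S p) \<and>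
        (\<Sum>p\<in>{1..k}. notified S p) < k)"

lemma msg_inv_start_CMY:
  assumes "0 < k" "\<not> alarm S" "0 < threshold S" "messages S \<le> 4 * k * rounds S"
  shows "msg_inv k (start_CMY k S)"
  using assms
  by (auto simp: msg_inv_def start_CMY_def start_straightforward_def start_slack_round_def
      new_round_def)

lemma msg_inv_start_DynSlk:
  assumes "0 < k" "\<not> alarm S" "0 < threshold S" "messages S \<le> 4 * k * rounds S"
  shows "msg_inv k (start_DynSlk k \<delta> \<mu> S)"
  using assms msg_inv_start_CMY[OF assms]
  by (auto simp: msg_inv_def start_DynSlk_def start_straightforward_def start_slack_round_def
      new_round_def Let_def)

lemma msg_inv_end_round:
  assumes "0 < k" "\<not> alarm S" "messages S + 2 * k \<le> 4 * k * rounds S"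
  shows "msg_inv k (end_round k \<delta> \<mu> S)"
proof -
  let ?S = "S\<lparr>messages := messages S + 2 * k,
              threshold := threshold S - (\<Sum>p\<in>{1..k}. counter S p)\<rparr>"
  consider "threshold ?S = 0" | "0 < threshold ?S" by blast
  then show ?thesis
  proof cases
    case 1
    then show ?thesis using assms by (simp add: end_round_def msg_inv_def)
  next
    case 2
    have S: "\<not> alarm ?S" "messages ?S \<le> 4 * k * rounds ?S" using assms by simp_all
    show ?thesis
      using 2 msg_inv_start_CMY[OF assms(1) S(1) 2 S(2)]
        msg_inv_start_DynSlk[OF assms(1) S(1) 2 S(2)]
      by (simp add: end_round_def Let_def)
  qed
qed

text \<open>A straightforward run pays one message per item, hence at most \<open>4 * k\<close> by
  the bound on its threshold. In a slack round the \<open>k\<close>-th notification leaves exactly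
  the \<open>2 * k\<close> messages needed for collecting.\<close>

lemma msg_inv_arrive:
  assumes k: "0 < k" and i: "i \<in> {1..k}" and S: "msg_inv k S"
  shows "msg_inv k (arrive k \<delta> \<mu> i S)"
proof (cases "alarm S")
  case True
  then show ?thesis using S by (simp add: arrive_def)
next
  case al: False
  define c where "c = (counter S)(i := Suc (counter S i))"
  define d where "d = (notified S)(i := Suc (notified S i))"
  have upd: "(\<Sum>p\<in>{1..k}. c p) = Suc (\<Sum>p\<in>{1..k}. counter S p)"
    "(\<Sum>p\<in>{1..k}. d p) = Suc (\<Sum>p\<in>{1..k}. notified S p)"
    unfolding c_def d_def by (rule sum_fun_upd_Suc[OF i])+
  show ?thesis
  proof (cases "mode S = Straightforward")
    case True
    have "arrive k \<delta> \<mu> i S = S\<lparr>counter := c, messages := messages S + 1,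
        alarm := ((\<Sum>p\<in>{1..k}. c p) = threshold S)\<rparr>"
      using True al by (simp add: arrive_def Let_def c_def)
    then show ?thesis using S True al upd(1) by (auto simp: msg_inv_def)
  next
    case False
    have nk: "messages S + 3 * k \<le> 4 * k * rounds S + (\<Sum>p\<in>{1..k}. notified S p)"
      "(\<Sum>p\<in>{1..k}. notified S p) < k"
      using S al False by (simp_all add: msg_inv_def)
    consider (quiet) "\<not> real (c i) \<ge> offset S i + real (notified S i + 1) * real (slack S)"
      | (notify) "real (c i) \<ge> offset S i + real (notified S i + 1) * real (slack S)"
          "(\<Sum>p\<in>{1..k}. d p) \<noteq> k"
      | (finish) "real (c i) \<ge> offset S i + real (notified S i + 1) * real (slack S)"
          "(\<Sum>p\<in>{1..k}. d p) = k"
      by blast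
    then show ?thesis
    proof cases
      case quiet
      then have "arrive k \<delta> \<mu> i S = S\<lparr>counter := c\<rparr>"
        using al False by (simp add: arrive_def Let_def c_def)
      then show ?thesis using al False nk by (simp add: msg_inv_def)
    next
      case notify
      then have "arrive k \<delta> \<mu> i S = S\<lparr>counter := c, notified := d, messages := messages S + 1\<rparr>"
        using al False by (simp add: arrive_def Let_def c_def d_def)
      then show ?thesis using al False nk upd(2) notify(2) by (simp add: msg_inv_def)
    next
      case finish
      then have "arrive k \<delta> \<mu> i S =
          end_round k \<delta> \<mu> (S\<lparr>counter := c, notified := d, messages := messages S + 1\<rparr>)"
        using al False by (simp add: arrive_def Let_def c_def d_def)
      moreover have "messages S + 1 + 2 * k \<le> 4 * k * rounds S"
        using nk finish(2) upd(2) by linarith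
      ultimately show ?thesis using msg_inv_end_round[OF k] al by simp
    qed
  qed
qed

text \<open>This holds on every arrival sequence, so only the number of rounds needs a probabilistic
  argument.\<close>

lemma messages_run_le:
  assumes k: "0 < k" and N: "0 < N" and xs: "set xs \<subseteq> {1..k}"
  shows "messages (run k \<delta> \<mu> N xs) \<le> 4 * k * rounds (run k \<delta> \<mu> N xs)"
proof -
  have "msg_inv k (run k \<delta> \<mu> N xs)" using xs
  proof (induction xs rule: rev_induct)
    case Nil
    show ?case unfolding run_def fold.simps id_apply
      by (rule msg_inv_start_DynSlk[OF k]) (use N in \<open>simp_all add: init_state_def\<close>)
  next
    case (snoc x xs)
    then show ?case using msg_inv_arrive[OF k] by (simp add: run_def)
  qed
  then show ?thesis by (auto simp: msg_inv_def split: if_splits)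
qed

section \<open>Tail probabilities\<close>

locale tracking =
  fixes k :: nat and \<delta> :: real and \<mu> :: "nat \<Rightarrow> real"
  assumes k: "0 < k" and \<delta>: "0 < \<delta>" "\<delta> < 1" and \<mu>: "prob_vector k \<mu>"
begin

abbreviation L :: real where "L \<equiv> ln (real k / \<delta>)"

lemma kd: "1 < real k / \<delta>" "real k \<le> real k / \<delta>"
proof -
  have "real k / \<delta> > real k" using k \<delta> by (simp add: field_simps)
  then show "1 < real k / \<delta>" "real k \<le> real k / \<delta>" using k by linarith+
qed

lemma L_pos: "0 < L" using kd by simp

lemma kL_pos: "0 < real k * L" using k L_pos by simp

lemma L_ge: assumes "k \<noteq> 1" shows "2 / 3 \<le> L"
proof -
  have "2 / 3 \<le> ln (2 :: real)" by (rule ln2_ge_two_thirds)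
  also have "\<dots> \<le> L" using kd k assms by (subst ln_le_cancel_iff) auto
  finally show ?thesis .
qed

lemma \<mu>_nonneg: "p \<in> {1..k} \<Longrightarrow> 0 \<le> \<mu> p" and \<mu>_sum: "(\<Sum>p\<in>{1..k}. \<mu> p) = 1"
  using \<mu> by (auto simp: prob_vector_def)

text \<open>The current state is an argument, so conditioning on the first item gives the recursion
  \<open>tail_Suc\<close>.\<close>

definition tail :: "nat \<Rightarrow> dt_state \<Rightarrow> nat \<Rightarrow> real" where
  "tail b S n = measure_pmf.prob (replicate_pmf n (item_pmf k \<mu>))
     {xs. b < rounds (fold (arrive k \<delta> \<mu>) xs S)}"

lemma tail_nonneg: "0 \<le> tail b S n" and tail_le_1: "tail b S n \<le> 1"
  by (simp_all add: tail_def)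

lemma tail_0: "tail b S 0 = (if b < rounds S then 1 else 0)"
  by (simp add: tail_def)

lemma tail_Suc: "tail b S (Suc n) = (\<Sum>p\<in>{1..k}. \<mu> p * tail b (arrive k \<delta> \<mu> p S) n)"
proof -
  have "emeasure (replicate_pmf (Suc n) (item_pmf k \<mu>))
      {xs. b < rounds (fold (arrive k \<delta> \<mu>) xs S)} =
      (\<integral>\<^sup>+ p. ennreal (tail b (arrive k \<delta> \<mu> p S) n) \<partial>item_pmf k \<mu>)"
    by (simp add: tail_def map_pmf_def[symmetric] vimage_def flip: measure_pmf.emeasure_eq_measure)
  then have "tail b S (Suc n) = measure_pmf.expectation (item_pmf k \<mu>)
      (\<lambda>p. tail b (arrive k \<delta> \<mu> p S) n)"
    by (simp add: tail_def[of b S] measure_def integral_eq_nn_integral tail_nonneg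
        del: replicate_pmf.simps)
  also have "\<dots> = (\<Sum>p\<in>{1..k}. \<mu> p * tail b (arrive k \<delta> \<mu> p S) n)"
    using set_item_pmf[OF \<mu>] pmf_item_pmf[OF \<mu>]
    by (subst integral_measure_pmf[of "{1..k}"]) auto
  finally show ?thesis .
qed

text \<open>Neither kind of state ever starts another round, and an arrival leads to a state of the
  same kind.\<close>

lemma tail_settled:
  assumes "alarm S \<or> mode S = Straightforward" "rounds S \<le> b"
  shows "tail b S n = 0"
  using assms
proof (induction n arbitrary: S)
  case (Suc n)
  have "tail b (arrive k \<delta> \<mu> p S) n = 0" for p
    by (rule Suc.IH) (use Suc.prems in \<open>auto simp: arrive_def Let_def\<close>)
  then show ?case by (simp add: tail_Suc)
qed (simp add: tail_0)

text \<open>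
  A round started in \<open>S\<close> changes only counters, notifications and messages until it ends, so an
  intermediate state is an update of \<open>S\<close> and a potential for the round depends on counters only.
\<close>

lemma tail_during_round:
  assumes S: "\<not> alarm S" "mode S \<noteq> Straightforward" "rounds S \<le> b"
    and \<Phi>: "\<And>c. 0 \<le> \<Phi> c" "\<And>c. (\<Sum>p\<in>{1..k}. \<mu> p * \<Phi> (c(p := Suc (c p)))) \<le> \<Phi> c"
    and fin: "\<And>c d m n. (\<Sum>p\<in>{1..k}. d p) = k \<Longrightarrow>
      (\<And>p. p \<in> {1..k} \<Longrightarrow> 0 < d p \<Longrightarrow> offset S p + real (d p) * real (slack S) \<le> real (c p)) \<Longrightarrow>
      tail b (end_round k \<delta> \<mu> (S\<lparr>counter := c, notified := d, messages := m\<rparr>)) n \<le> \<Phi> c"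
    and cd: "\<And>p. p \<in> {1..k} \<Longrightarrow> 0 < d p \<Longrightarrow>
      offset S p + real (d p) * real (slack S) \<le> real (c p)"
  shows "tail b (S\<lparr>counter := c, notified := d, messages := m\<rparr>) n \<le> \<Phi> c"
  using cd
proof (induction n arbitrary: c d m)
  case 0
  then show ?case using S \<Phi> by (simp add: tail_0)
next
  case (Suc n)
  let ?T = "S\<lparr>counter := c, notified := d, messages := m\<rparr>"
  have "tail b (arrive k \<delta> \<mu> p ?T) n \<le> \<Phi> (c(p := Suc (c p)))" if p: "p \<in> {1..k}" for p
  proof (cases "offset S p + real (d p + 1) * real (slack S) \<le> real (Suc (c p))")
    case False
    then have "arrive k \<delta> \<mu> p ?T = S\<lparr>counter := c(p := Suc (c p)), notified := d, messages := m\<rparr>"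
      using S by (simp add: arrive_def Let_def)
    also have "tail b \<dots> n \<le> \<Phi> (c(p := Suc (c p)))"
    proof (rule Suc.IH)
      fix q assume "q \<in> {1..k}" "0 < d q"
      from Suc.prems[OF this]
      show "offset S q + real (d q) * real (slack S) \<le> real ((c(p := Suc (c p))) q)" by auto
    qed
    finally show ?thesis .
  next
    case True
    let ?S = "S\<lparr>counter := c(p := Suc (c p)), notified := d(p := Suc (d p)), messages := Suc m\<rparr>"
    have inv: "offset S q + real ((d(p := Suc (d p))) q) * real (slack S)
        \<le> real ((c(p := Suc (c p))) q)" if "q \<in> {1..k}" "0 < (d(p := Suc (d p))) q" for q
      using that True Suc.prems[of q] by (cases "q = p") (auto simp: algebra_simps)
    have eq: "arrive k \<delta> \<mu> p ?T =
        (if (\<Sum>q\<in>{1..k}. (d(p := Suc (d p))) q) = k then end_round k \<delta> \<mu> ?S else ?S)"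
      using S True by (simp add: arrive_def Let_def)
    show ?thesis
    proof (cases "(\<Sum>q\<in>{1..k}. (d(p := Suc (d p))) q) = k")
      case True
      show ?thesis unfolding eq if_P[OF True] by (rule fin[OF True]) (rule inv)
    next
      case False
      show ?thesis unfolding eq if_not_P[OF False] by (rule Suc.IH) (rule inv)
    qed
  qed
  then have "tail b ?T (Suc n) \<le> (\<Sum>p\<in>{1..k}. \<mu> p * \<Phi> (c(p := Suc (c p))))"
    unfolding tail_Suc by (intro sum_mono mult_left_mono \<mu>_nonneg)
  also have "\<dots> \<le> \<Phi> c" by (rule \<Phi>)
  finally show ?case .
qed

text \<open>A verification rule for one round: it remains to find a potential that dominates the
  tail of whatever follows. The strict bound on \<open>rounds S\<close> pays for the round being
  started, and the case of an alarm at its end is settled here.\<close>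

lemma tail_slack_round:
  fixes \<Phi> :: "(nat \<Rightarrow> nat) \<Rightarrow> real"
  assumes S: "\<not> alarm S" "md \<noteq> Straightforward" "rounds S < b"
    and \<Phi>: "\<And>c. 0 \<le> \<Phi> c" "\<And>c. (\<Sum>p\<in>{1..k}. \<mu> p * \<Phi> (c(p := Suc (c p)))) \<le> \<Phi> c"
    and fin: "\<And>c d S' n. (\<Sum>p\<in>{1..k}. d p) = k \<Longrightarrow>
      (\<And>p. p \<in> {1..k} \<Longrightarrow> 0 < d p \<Longrightarrow> off p + real (d p) * real s \<le> real (c p)) \<Longrightarrow>
      \<not> alarm S' \<Longrightarrow> rounds S' = Suc (rounds S) \<Longrightarrow> mode S' = md \<Longrightarrow>
      threshold S' = threshold S - (\<Sum>p\<in>{1..k}. c p) \<Longrightarrow> 0 < threshold S' \<Longrightarrow>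
      tail b (if md = CMY then start_CMY k S' else start_DynSlk k \<delta> \<mu> S') n \<le> \<Phi> c"
  shows "tail b (start_slack_round k md off s S) n \<le> \<Phi> (\<lambda>_. 0)"
proof -
  let ?S = "start_slack_round k md off s S"
  \<comment> \<open>A fresh round is written as a trivial update of itself, the form that
    \<open>tail_during_round\<close> expects.\<close>
  have "tail b (?S\<lparr>counter := \<lambda>_. 0, notified := \<lambda>_. 0, messages := messages S + k\<rparr>) n \<le> \<Phi> (\<lambda>_. 0)"
  proof (rule tail_during_round[where \<Phi> = \<Phi>])
    show "(\<Sum>p\<in>{1..k}. \<mu> p * \<Phi> (c(p := Suc (c p)))) \<le> \<Phi> c" for c by (rule \<Phi>(2))
  next
    fix c d :: "nat \<Rightarrow> nat" and m n :: nat
    assume sum: "(\<Sum>p\<in>{1..k}. d p) = k" and "\<And>p. p \<in> {1..k} \<Longrightarrow> 0 < d p \<Longrightarrow>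
      offset ?S p + real (d p) * real (slack ?S) \<le> real (c p)"
    then have inv: "\<And>p. p \<in> {1..k} \<Longrightarrow> 0 < d p \<Longrightarrow> off p + real (d p) * real s \<le> real (c p)"
      by (simp add: start_slack_round_def)
    let ?T = "?S\<lparr>counter := c, notified := d, messages := m\<rparr>"
    let ?S' = "?T\<lparr>messages := m + 2 * k, threshold := threshold S - (\<Sum>p\<in>{1..k}. c p)\<rparr>"
    have thr: "threshold ?S = threshold S" "rounds ?S = Suc (rounds S)" "mode ?S = md"
      "alarm ?S = alarm S"
      by (simp_all add: start_slack_round_def new_round_def)
    show "tail b (end_round k \<delta> \<mu> ?T) n \<le> \<Phi> c"
    proof (cases "threshold ?S' = 0")
      case True
      then have "alarm (end_round k \<delta> \<mu> ?T)" "rounds (end_round k \<delta> \<mu> ?T) \<le> b"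
        using S thr by (simp_all add: end_round_def)
      then show ?thesis using \<Phi>(1)[of c] by (simp add: tail_settled)
    next
      case False
      have "end_round k \<delta> \<mu> ?T =
          (if md = CMY then start_CMY k ?S' else start_DynSlk k \<delta> \<mu> ?S')"
        using False thr by (simp add: end_round_def Let_def)
      moreover have "tail b (if md = CMY then start_CMY k ?S' else start_DynSlk k \<delta> \<mu> ?S') n \<le> \<Phi> c"
        by (rule fin[OF sum inv]) (use False S thr in simp_all)
      ultimately show ?thesis by simp
    qed
  qed (use S \<Phi>(1) in \<open>simp_all add: start_slack_round_def new_round_def\<close>)
  moreover have "?S\<lparr>counter := \<lambda>_. 0, notified := \<lambda>_. 0, messages := messages S + k\<rparr> = ?S"
    by (cases S) (simp add: start_slack_round_def new_round_def)
  ultimately show ?thesis by (simp only:)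
qed

section \<open>Items certified by notifications, and the \<open>CMY\<close> phase\<close>

text \<open>As offsets are nonnegative, each notification certifies \<open>s\<close> items of its
  own at its sender, and there are \<open>k\<close> notifications.\<close>

lemma counters_ge_slack:
  fixes s :: nat
  assumes "(\<Sum>p\<in>{1..k}. d p) = k" "\<And>p. p \<in> {1..k} \<Longrightarrow> 0 \<le> off p"
    and "\<And>p. p \<in> {1..k} \<Longrightarrow> 0 < d p \<Longrightarrow> off p + real (d p) * real s \<le> real (c p)"
  shows "real k * real s \<le> real (\<Sum>p\<in>{1..k}. c p)"
proof -
  have "real k * real s = (\<Sum>p\<in>{1..k}. real (d p) * real s)"
    by (subst assms(1)[symmetric]) (simp add: sum_distrib_right)
  also have "\<dots> \<le> (\<Sum>p\<in>{1..k}. real (c p))"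
  proof (rule sum_mono)
    fix p assume "p \<in> {1..k}"
    then show "real (d p) * real s \<le> real (c p)"
      using assms(2)[of p] assms(3)[of p] by (cases "d p = 0") auto
  qed
  finally show ?thesis by simp
qed

text \<open>Deterministic, hence the potential 0: every round removes at least a quarter of the
  threshold. At most \<open>j\<close> slack rounds occur, and the strict inequality leaves room for
  the final straightforward run.\<close>

lemma tail_start_CMY:
  assumes "\<not> alarm S" "real (threshold S) < 4 * real k * (4 / 3) ^ j" "rounds S + j < b"
  shows "tail b (start_CMY k S) n \<le> 0"
  using assms
proof (induction j arbitrary: S n)
  case 0
  then have "threshold S < 4 * k" by (simp flip: of_nat_less_iff)
  then show ?case using 0
    by (simp add: start_CMY_def start_straightforward_def new_round_def tail_settled)
next
  case (Suc j)
  let ?N = "threshold S"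
  let ?s = "?N div (2 * k)"
  show ?case
  proof (cases "?N < 4 * k")
    case True
    then show ?thesis using Suc.prems
      by (simp add: start_CMY_def start_straightforward_def new_round_def tail_settled)
  next
    case False
    have "real ?N < real (2 * k) * (real ?s + 1)"
    proof -
      have "?N < 2 * k * (?s + 1)"
        using k dividend_less_div_times[of "2 * k" ?N] by (simp add: algebra_simps)
      then have "real ?N < real (2 * k * (?s + 1))" by (subst of_nat_less_iff)
      then show ?thesis by (simp add: algebra_simps)
    qed
    \<comment> \<open>\<open>k * ?s\<close> exceeds \<open>?N / 2 - k\<close>, and \<open>k\<close>
      is at most \<open>?N / 4\<close>.\<close>
    then have ks: "real ?N / 4 \<le> real k * real ?s" using False by (simp add: algebra_simps)
    have "tail b (start_slack_round k CMY (\<lambda>_. 0) ?s S) n \<le> 0"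
    proof (rule tail_slack_round[where \<Phi> = "\<lambda>_. 0"])
      fix c d :: "nat \<Rightarrow> nat" and S' :: dt_state and n :: nat
      assume d: "(\<Sum>p\<in>{1..k}. d p) = k"
        "\<And>p. p \<in> {1..k} \<Longrightarrow> 0 < d p \<Longrightarrow> 0 + real (d p) * real ?s \<le> real (c p)"
        and S': "\<not> alarm S'" "rounds S' = Suc (rounds S)"
          "threshold S' = ?N - (\<Sum>p\<in>{1..k}. c p)" "0 < threshold S'"
      have "real k * real ?s \<le> real (\<Sum>p\<in>{1..k}. c p)"
        by (rule counters_ge_slack[OF d(1) _ d(2)]) simp_all
      then have "real (threshold S') \<le> real ?N * (3 / 4)" using S'(3,4) ks by linarith
      also have "\<dots> < 4 * real k * (4 / 3) ^ j" using Suc.prems(2) by simp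
      finally show "tail b (if CMY = CMY then start_CMY k S' else start_DynSlk k \<delta> \<mu> S') n \<le> 0"
        using Suc.IH[of S'] S' Suc.prems by simp
    qed (use Suc.prems in auto)
    then show ?thesis using False by (simp add: start_CMY_def)
  qed
qed

section \<open>DynSlk rounds\<close>

definition dyn_slack :: "nat \<Rightarrow> nat" where
  "dyn_slack N = nat \<lfloor>(real N - dyn_target k \<delta> N) / (2 * real k)\<rfloor>"

definition radius :: "nat \<Rightarrow> real" where
  "radius N = sqrt (real k * real N * L)"

lemma dyn_target_radius: "dyn_target k \<delta> N = real N - dyn_const * radius N"
  by (simp add: dyn_target_def radius_def)

lemma radius_square: "(radius N)\<^sup>2 = real k * real N * L"
  using L_pos by (simp add: radius_def)

lemma radius_nonneg: "0 \<le> radius N"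
  using L_pos by (simp add: radius_def)

context
  fixes N :: nat
  assumes big: "2 * dyn_const\<^sup>2 * real k * L < real N"
begin

lemma N_gt: "8 * (real k * L) < real N"
proof -
  have "8 * (real k * L) \<le> 2 * dyn_const\<^sup>2 * (real k * L)"
    using power_mono[OF dyn_const_bounds, of 2] kL_pos by (intro mult_right_mono) auto
  also have "\<dots> < real N" using big by (simp only: mult.assoc)
  finally show ?thesis .
qed

lemma N_pos: "0 < real N" using N_gt kL_pos by linarith

text \<open>The factor 2/5 is what makes \<open>tilt\<close> at most 1.\<close>

lemma radius_le: "radius N \<le> 2 / 5 * real N"
proof (rule power2_le_imp_le)
  have "(radius N)\<^sup>2 = (real k * L) * real N" by (simp add: radius_square)
  also have "\<dots> \<le> (real N / 8) * real N" using N_gt N_pos by (intro mult_right_mono) auto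
  also have "\<dots> \<le> (2 / 5 * real N)\<^sup>2" by (simp add: power2_eq_square)
  finally show "(radius N)\<^sup>2 \<le> (2 / 5 * real N)\<^sup>2" .
qed simp

text \<open>So the target is at least \<open>N / 4\<close>, which gives progress for a single
  player.\<close>

lemma dyn_const_radius_le: "dyn_const * radius N \<le> 3 / 4 * real N"
proof (rule power2_le_imp_le)
  have "(dyn_const * radius N)\<^sup>2 = (dyn_const\<^sup>2 * real k * L) * real N"
    by (simp add: radius_square power_mult_distrib)
  also have "\<dots> \<le> (real N / 2) * real N" using big N_pos by (intro mult_right_mono) auto
  also have "\<dots> \<le> (3 / 4 * real N)\<^sup>2" by (simp add: power2_eq_square)
  finally show "(dyn_const * radius N)\<^sup>2 \<le> (3 / 4 * real N)\<^sup>2" .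
qed simp

lemma radius_ge: "14 / 5 * (real k * L) \<le> radius N"
proof (rule power2_le_imp_le)
  have "(14 / 5 * (real k * L))\<^sup>2 \<le> (real k * L) * (8 * (real k * L))"
    by (simp add: power2_eq_square)
  also have "\<dots> \<le> (real k * L) * real N" using N_gt kL_pos by (intro mult_left_mono) auto
  also have "\<dots> = (radius N)\<^sup>2" by (simp add: radius_square)
  finally show "(14 / 5 * (real k * L))\<^sup>2 \<le> (radius N)\<^sup>2" .
qed (rule radius_nonneg)

text \<open>Before rounding, \<open>k\<close> times the slack is at least the radius. The floor
  loses at most \<open>k\<close>, which is at most 3/5 of the radius because
  \<open>L \<ge> 2 / 3\<close>. For \<open>k = 1\<close>, \<open>L\<close> can be so small that the
  slack is 0.\<close>

lemma dyn_slack_ge: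
  assumes "k \<noteq> 1"
  shows "2 / 5 * radius N \<le> real k * real (dyn_slack N)"
proof -
  have "real k * (2 / 3) \<le> real k * L" using L_ge[OF assms] by (intro mult_left_mono) auto
  then have k_le: "real k \<le> 3 / 5 * radius N" using radius_ge by linarith
  have "2 * radius N \<le> dyn_const * radius N"
    using dyn_const_bounds radius_nonneg by (intro mult_right_mono)
  then have "2 * radius N / (2 * real k) \<le> (real N - dyn_target k \<delta> N) / (2 * real k)"
    by (intro divide_right_mono) (simp_all add: dyn_target_radius)
  then have "radius N / real k \<le> (real N - dyn_target k \<delta> N) / (2 * real k)" by simp
  then have "radius N / real k - 1 \<le> real (dyn_slack N)" unfolding dyn_slack_def by linarith
  then have "radius N - real k \<le> real k * real (dyn_slack N)" using k by (simp add: field_simps)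
  then show ?thesis using k_le by linarith
qed

lemma dyn_target_pos: "0 < dyn_target k \<delta> N"
  by (rule DynSlk_round_bounds(1)[OF k \<delta> big])

lemma offset_nonneg: "p \<in> {1..k} \<Longrightarrow> 0 \<le> \<mu> p * dyn_target k \<delta> N"
  using dyn_target_pos \<mu>_nonneg by simp

text \<open>The only player has probability 1 and its first notification ends the round, so the
  round cannot end before the target.\<close>

lemma single_player_counters:
  assumes "k = 1" "(\<Sum>p\<in>{1..k}. d p) = k"
    and "\<And>p. p \<in> {1..k} \<Longrightarrow> 0 < d p \<Longrightarrow>
      \<mu> p * dyn_target k \<delta> N + real (d p) * real (dyn_slack N) \<le> real (c p)"
  shows "dyn_target k \<delta> N \<le> real (\<Sum>p\<in>{1..k}. c p)"
proof -
  have "\<mu> 1 = 1" "d 1 = 1" using \<mu>_sum assms(1,2) by simp_all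
  then have "dyn_target k \<delta> N + real (dyn_slack N) \<le> real (c 1)"
    using assms(3)[of 1] assms(1) by simp
  then show ?thesis using assms(1) by simp
qed

text \<open>This sure progress, however unlucky the arrivals, bounds the rounds left once the
  threshold is a constant multiple of \<open>k * L\<close>.\<close>

lemma DynSlk_progress:
  assumes "(\<Sum>p\<in>{1..k}. d p) = k"
    and "\<And>p. p \<in> {1..k} \<Longrightarrow> 0 < d p \<Longrightarrow>
      \<mu> p * dyn_target k \<delta> N + real (d p) * real (dyn_slack N) \<le> real (c p)"
  shows "real k * L \<le> real (\<Sum>p\<in>{1..k}. c p)"
proof (cases "k = 1")
  case True
  have "real k * L \<le> 1 / 4 * real N" using N_gt kL_pos by linarith
  also have "\<dots> \<le> dyn_target k \<delta> N" using dyn_const_radius_le by (simp add: dyn_target_radius)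
  also have "\<dots> \<le> real (\<Sum>p\<in>{1..k}. c p)" by (rule single_player_counters[OF True assms])
  finally show ?thesis .
next
  case False
  have "real k * L \<le> 2 / 5 * radius N" using radius_ge kL_pos by linarith
  also have "\<dots> \<le> real k * real (dyn_slack N)" by (rule dyn_slack_ge[OF False])
  also have "\<dots> \<le> real (\<Sum>p\<in>{1..k}. c p)"
    by (rule counters_ge_slack[OF assms(1) offset_nonneg assms(2)])
  finally show ?thesis .
qed

section \<open>The exponential supermartingales of a \<open>DynSlk\<close> round\<close>

text \<open>The factor 5/2 cancels the 2/5 of \<open>dyn_slack_ge\<close>, so that
  \<open>tilt\<close> times the slack reaches \<open>L\<close>, while \<open>tilt * N\<close> stays
  of the order of the radius.\<close>

definition tilt :: real where "tilt = 5 / 2 * radius N / real N"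

definition martingale :: "(nat \<Rightarrow> nat) \<Rightarrow> nat \<Rightarrow> real" where
  "martingale c i =
     exp (tilt * real (c i) - real (\<Sum>p\<in>{1..k}. c p) * (\<mu> i * (tilt + tilt\<^sup>2)))"

lemma tilt_bounds: "0 \<le> tilt" "tilt \<le> 1"
  using radius_nonneg radius_le N_pos by (simp_all add: tilt_def field_simps)

lemma tilt_mult_N: "tilt * real N = 5 / 2 * radius N"
  using N_pos by (simp add: tilt_def)

text \<open>An item multiplies the value by \<open>exp tilt / A\<close> with probability
  \<open>\<mu> i\<close> and by \<open>1 / A\<close> otherwise; by
  \<open>exp_bound_quadratic\<close> the mean factor is at most 1.\<close>

lemma martingale_step:
  assumes i: "i \<in> {1..k}"
  shows "(\<Sum>p\<in>{1..k}. \<mu> p * martingale (c(p := Suc (c p))) i) \<le> martingale c i"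
proof -
  define A where "A = exp (\<mu> i * (tilt + tilt\<^sup>2))"
  have A: "0 < A" by (simp add: A_def)
  have step: "martingale (c(p := Suc (c p))) i =
      martingale c i / A * (if p = i then exp tilt else 1)" if "p \<in> {1..k}" for p
    unfolding martingale_def A_def sum_fun_upd_Suc[OF that]
    by (simp add: algebra_simps flip: exp_diff exp_add)
  have "(\<Sum>p\<in>{1..k}. \<mu> p * martingale (c(p := Suc (c p))) i) =
      (\<Sum>p\<in>{1..k}. martingale c i / A * (\<mu> p * (if p = i then exp tilt else 1)))"
    by (intro sum.cong refl) (simp add: step)
  also have "\<dots> = martingale c i / A * (\<Sum>p\<in>{1..k}. \<mu> p * (if p = i then exp tilt else 1))"
    by (rule sum_distrib_left[symmetric])
  also have "(\<Sum>p\<in>{1..k}. \<mu> p * (if p = i then exp tilt else 1)) =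
      (\<Sum>p\<in>{1..k}. \<mu> p + (if p = i then \<mu> i * (exp tilt - 1) else 0))"
    by (intro sum.cong refl) (simp add: algebra_simps)
  also have "\<dots> = 1 + \<mu> i * (exp tilt - 1)"
    using i \<mu>_sum by (simp add: sum.distrib)
  also have "martingale c i / A * \<dots> \<le> martingale c i / A * A"
    unfolding A_def using exp_bound_quadratic[OF tilt_bounds \<mu>_nonneg[OF i]]
    by (intro mult_left_mono) (simp_all add: martingale_def)
  also have "\<dots> = martingale c i" using A by simp
  finally show ?thesis .
qed

text \<open>One notification suffices: its sender has at least \<open>\<mu> i * ?t + ?s\<close>
  items. Ending early gives \<open>?n * (1 + tilt) \<le> ?t\<close>, so the compensator is at most
  \<open>tilt * (\<mu> i * ?t)\<close> and the exponent keeps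
  \<open>tilt * ?s \<ge> L\<close>.\<close>

lemma early_end_martingale:
  assumes k1: "k \<noteq> 1" and d: "(\<Sum>p\<in>{1..k}. d p) = k"
    and inv: "\<And>p. p \<in> {1..k} \<Longrightarrow> 0 < d p \<Longrightarrow>
      \<mu> p * dyn_target k \<delta> N + real (d p) * real (dyn_slack N) \<le> real (c p)"
    and early: "real (\<Sum>p\<in>{1..k}. c p) < dyn_target k \<delta> N - tilt * real N"
  obtains i where "i \<in> {1..k}" "real k / \<delta> \<le> martingale c i"
proof -
  obtain i where i: "i \<in> {1..k}" "0 < d i"
    using d k by (metis gr0I less_numeral_extra(3) sum.neutral)
  let ?t = "dyn_target k \<delta> N" and ?n = "real (\<Sum>p\<in>{1..k}. c p)" and ?s = "real (dyn_slack N)"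
  note mu = \<mu>_nonneg[OF i(1)]
  have "?s \<le> real (d i) * ?s" using i(2) by (intro mult_le_cancel_right1[THEN iffD2]) auto
  then have ci: "\<mu> i * ?t + ?s \<le> real (c i)" using inv[OF i] by linarith
  have L: "L \<le> tilt * ?s"
  proof -
    have "L * (real k * real N) = radius N * radius N"
      using radius_square by (simp add: power2_eq_square mult_ac)
    also have "\<dots> = (5 / 2 * radius N) * (2 / 5 * radius N)" by simp
    also have "\<dots> \<le> (5 / 2 * radius N) * (real k * ?s)"
      using radius_nonneg dyn_slack_ge[OF k1] by (intro mult_left_mono) auto
    also have "\<dots> = (tilt * real N) * (real k * ?s)" by (simp only: tilt_mult_N)
    also have "\<dots> = (tilt * ?s) * (real k * real N)" by simp
    finally show ?thesis using k N_pos by simp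
  qed
  have "?n * (1 + tilt) = ?n + tilt * ?n" by (simp add: algebra_simps)
  also have "\<dots> \<le> ?n + tilt * real N"
  proof -
    have "?t \<le> real N" by (rule DynSlk_round_bounds(2)[OF k \<delta> big])
    moreover have "0 \<le> tilt * real N" using tilt_bounds by simp
    ultimately have "?n \<le> real N" using early by linarith
    then show ?thesis using tilt_bounds by (intro add_left_mono mult_left_mono)
  qed
  also have "\<dots> \<le> ?t" using early by linarith
  finally have nt: "?n * (1 + tilt) \<le> ?t" .
  have "?n * (\<mu> i * (tilt + tilt\<^sup>2)) = tilt * (\<mu> i * (?n * (1 + tilt)))"
    by (simp add: power2_eq_square algebra_simps)
  also have "\<dots> \<le> tilt * (\<mu> i * ?t)"
    using nt mu tilt_bounds by (intro mult_left_mono)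
  finally have "tilt * ?s \<le> tilt * (\<mu> i * ?t + ?s) - ?n * (\<mu> i * (tilt + tilt\<^sup>2))"
    by (simp add: algebra_simps)
  also have "\<dots> \<le> tilt * real (c i) - ?n * (\<mu> i * (tilt + tilt\<^sup>2))"
    using ci tilt_bounds by (intro diff_right_mono mult_left_mono)
  finally have "exp L \<le> martingale c i" using L unfolding martingale_def
    by (subst exp_le_cancel_iff) linarith
  then show ?thesis using that i(1) kd by simp
qed

end

section \<open>Round budgets for the whole algorithm\<close>

lemma start_DynSlk_cases:
  assumes "\<not> alarm S" "rounds S < b"
    and CMY: "real (threshold S) \<le> 2 * dyn_const\<^sup>2 * real k * L \<Longrightarrow> tail b (start_CMY k S) n \<le> B"
    and Dyn: "2 * dyn_const\<^sup>2 * real k * L < real (threshold S) \<Longrightarrow>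
      tail b (start_slack_round k DynSlk (\<lambda>i. \<mu> i * dyn_target k \<delta> (threshold S))
        (dyn_slack (threshold S)) S) n \<le> B"
    and B: "0 \<le> B"
  shows "tail b (start_DynSlk k \<delta> \<mu> S) n \<le> B"
proof (cases "threshold S \<le> 4 * k")
  case True
  then have "tail b (start_DynSlk k \<delta> \<mu> S) n = 0"
    using assms by (intro tail_settled) (simp_all add: start_DynSlk_def start_straightforward_def new_round_def)
  then show ?thesis using B by simp
next
  case False
  then show ?thesis using CMY Dyn
    by (cases "real (threshold S) \<le> 2 * dyn_const\<^sup>2 * real k * L")
      (simp_all add: start_DynSlk_def dyn_slack_def Let_def)
qed

text \<open>Source of the constant 9 in \<open>CMY_levels\<close>.\<close>

lemma CMY_cutoff_le: "2 * dyn_const\<^sup>2 * real k * L \<le> 9 * (real k * L)"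
proof -
  have "dyn_const\<^sup>2 \<le> (21 / 10)\<^sup>2"
    using dyn_const_le dyn_const_bounds by (intro power_mono) auto
  then have "2 * dyn_const\<^sup>2 \<le> 9" by (simp add: power2_eq_square)
  then have "2 * dyn_const\<^sup>2 * (real k * L) \<le> 9 * (real k * L)"
    using kL_pos by (intro mult_right_mono) auto
  then show ?thesis by (simp add: mult.assoc)
qed

context
  fixes Jc :: nat
  assumes Jc: "9 * L < 4 * (4 / 3) ^ Jc"
begin

lemma tail_start_CMY_from_DynSlk:
  assumes "\<not> alarm S" "real (threshold S) \<le> 2 * dyn_const\<^sup>2 * real k * L" "rounds S + Jc < b"
  shows "tail b (start_CMY k S) n \<le> 0"
proof (rule tail_start_CMY[OF assms(1) _ assms(3)])
  have "real k * (9 * L) < real k * (4 * (4 / 3) ^ Jc)"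
    using Jc k by (intro mult_strict_left_mono) auto
  then show "real (threshold S) < 4 * real k * (4 / 3) ^ Jc"
    using assms(2) CMY_cutoff_le by simp
qed

text \<open>A \<open>DynSlk\<close> round starts only above \<open>8 * k * L\<close> and removes at
  least \<open>k * L\<close>, so at most \<open>j\<close> of them occur before \<open>CMY\<close> or
  the straightforward run.\<close>

lemma tail_start_DynSlk_small:
  assumes "\<not> alarm S" "real (threshold S) \<le> (8 + real j) * (real k * L)" "rounds S + j + Jc < b"
  shows "tail b (start_DynSlk k \<delta> \<mu> S) n \<le> 0"
  using assms
proof (induction j arbitrary: S n)
  case 0
  show ?case
  proof (rule start_DynSlk_cases)
    assume "2 * dyn_const\<^sup>2 * real k * L < real (threshold S)"
    from N_gt[OF this] 0(2)
    show "tail b (start_slack_round k DynSlk (\<lambda>i. \<mu> i * dyn_target k \<delta> (threshold S))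
        (dyn_slack (threshold S)) S) n \<le> 0" by simp
  qed (use 0 tail_start_CMY_from_DynSlk in auto)
next
  case (Suc j)
  show ?case
  proof (rule start_DynSlk_cases)
    assume big: "2 * dyn_const\<^sup>2 * real k * L < real (threshold S)"
    show "tail b (start_slack_round k DynSlk (\<lambda>i. \<mu> i * dyn_target k \<delta> (threshold S))
        (dyn_slack (threshold S)) S) n \<le> 0"
    proof (rule tail_slack_round[where \<Phi> = "\<lambda>_. 0"])
      fix c d :: "nat \<Rightarrow> nat" and S' :: dt_state and n :: nat
      assume d: "(\<Sum>p\<in>{1..k}. d p) = k" "\<And>p. p \<in> {1..k} \<Longrightarrow> 0 < d p \<Longrightarrow>
          \<mu> p * dyn_target k \<delta> (threshold S) + real (d p) * real (dyn_slack (threshold S)) \<le> real (c p)"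
        and S': "\<not> alarm S'" "rounds S' = Suc (rounds S)"
          "threshold S' = threshold S - (\<Sum>p\<in>{1..k}. c p)" "0 < threshold S'"
      have "real (threshold S') \<le> real (threshold S) - real k * L"
        using DynSlk_progress[OF big d] S'(3,4) by linarith
      also have "\<dots> \<le> (8 + real j) * (real k * L)" using Suc.prems(2) by (simp add: algebra_simps)
      finally show "tail b (if DynSlk = CMY then start_CMY k S' else start_DynSlk k \<delta> \<mu> S') n \<le> 0"
        using Suc.IH[of S'] S' Suc.prems by simp
    qed (use Suc.prems in auto)
  qed (use Suc.prems tail_start_CMY_from_DynSlk in auto)
qed

lemma tail_start_DynSlk:
  defines "\<epsilon> \<equiv> if k = 1 then 0 else \<delta>"
  assumes "\<not> alarm S" "real (threshold S) \<le> 25 * 2 ^ 2 ^ j * (real k * L)"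
    "rounds S + j + 42 + Jc < b"
  shows "tail b (start_DynSlk k \<delta> \<mu> S) n \<le> \<epsilon> * real j"
  using assms(2-)
proof (induction j arbitrary: S n)
  case 0
  \<comment> \<open>\<open>25 \<cdot> 2 = 8 + 42\<close>\<close>
  then show ?case using tail_start_DynSlk_small[of S 42] by simp
next
  case (Suc j)
  have \<epsilon>: "0 \<le> \<epsilon>" using \<delta> by (simp add: \<epsilon>_def)
  then have "0 \<le> \<epsilon> * real (Suc j)" by simp
  show ?case
  proof (rule start_DynSlk_cases)
    let ?N = "threshold S"
    assume big: "2 * dyn_const\<^sup>2 * real k * L < real ?N"
    let ?W = "martingale ?N"
    \<comment> \<open>The first term covers the later rounds. The second is a union bound over the
      players: it starts at \<open>\<epsilon>\<close>, and for \<open>k \<noteq> 1\<close> it is at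
      least 1 once some \<open>?W c i\<close> reaches \<open>k / \<delta>\<close>.\<close>
    define \<Phi> where "\<Phi> c = \<epsilon> * real j + \<epsilon> / real k * (\<Sum>i\<in>{1..k}. ?W c i)" for c
    have W_nonneg: "0 \<le> ?W c i" for c i by (simp add: martingale_def[OF big])
    have \<Phi>_ge: "\<epsilon> * real j \<le> \<Phi> c" "0 \<le> \<Phi> c" for c
    proof -
      have "0 \<le> \<epsilon> / real k * (\<Sum>i\<in>{1..k}. ?W c i)"
        using \<epsilon> W_nonneg by (intro mult_nonneg_nonneg sum_nonneg divide_nonneg_nonneg) auto
      then show "\<epsilon> * real j \<le> \<Phi> c" by (simp add: \<Phi>_def)
      then show "0 \<le> \<Phi> c" using \<epsilon> order_trans[of 0 "\<epsilon> * real j" "\<Phi> c"] by simp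
    qed
    have "tail b (start_slack_round k DynSlk (\<lambda>i. \<mu> i * dyn_target k \<delta> ?N) (dyn_slack ?N) S) n
        \<le> \<Phi> (\<lambda>_. 0)"
    proof (rule tail_slack_round)
      fix c
      have "(\<Sum>p\<in>{1..k}. \<mu> p * \<Phi> (c(p := Suc (c p)))) =
          \<epsilon> * real j * (\<Sum>p\<in>{1..k}. \<mu> p) +
          \<epsilon> / real k * (\<Sum>p\<in>{1..k}. \<Sum>i\<in>{1..k}. \<mu> p * ?W (c(p := Suc (c p))) i)"
        by (simp add: \<Phi>_def sum_distrib_left sum.distrib algebra_simps)
      also have "(\<Sum>p\<in>{1..k}. \<Sum>i\<in>{1..k}. \<mu> p * ?W (c(p := Suc (c p))) i) =
          (\<Sum>i\<in>{1..k}. \<Sum>p\<in>{1..k}. \<mu> p * ?W (c(p := Suc (c p))) i)"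
        by (rule sum.swap)
      also have "\<epsilon> * real j * (\<Sum>p\<in>{1..k}. \<mu> p) + \<epsilon> / real k * \<dots> \<le> \<Phi> c"
        unfolding \<Phi>_def \<mu>_sum mult_1_right
        using \<epsilon> by (intro add_left_mono mult_left_mono sum_mono martingale_step[OF big]) auto
      finally show "(\<Sum>p\<in>{1..k}. \<mu> p * \<Phi> (c(p := Suc (c p)))) \<le> \<Phi> c" .
    next
      fix c d :: "nat \<Rightarrow> nat" and S' :: dt_state and n :: nat
      assume d: "(\<Sum>p\<in>{1..k}. d p) = k" "\<And>p. p \<in> {1..k} \<Longrightarrow> 0 < d p \<Longrightarrow>
          \<mu> p * dyn_target k \<delta> ?N + real (d p) * real (dyn_slack ?N) \<le> real (c p)"
        and S': "\<not> alarm S'" "rounds S' = Suc (rounds S)"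
          "threshold S' = ?N - (\<Sum>p\<in>{1..k}. c p)" "0 < threshold S'"
      let ?n = "real (\<Sum>p\<in>{1..k}. c p)"
      have "tail b (start_DynSlk k \<delta> \<mu> S') n \<le> \<Phi> c"
      proof (cases "?n < dyn_target k \<delta> ?N - tilt ?N * real ?N")
        case True
        have k1: "k \<noteq> 1"
        proof
          assume "k = 1"
          from single_player_counters[OF big this d] True show False
            using mult_nonneg_nonneg[OF tilt_bounds(1)[OF big] of_nat_0_le_iff[of ?N]] by linarith
        qed
        obtain i where i: "i \<in> {1..k}" "real k / \<delta> \<le> ?W c i"
          using early_end_martingale[OF big k1 d True] by blast
        have "1 = \<epsilon> / real k * (real k / \<delta>)" using k k1 \<delta> by (simp add: \<epsilon>_def)
        also have "\<dots> \<le> \<epsilon> / real k * (\<Sum>i\<in>{1..k}. ?W c i)"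
        proof (rule mult_left_mono)
          have "?W c i \<le> (\<Sum>i\<in>{1..k}. ?W c i)" using i(1) W_nonneg by (intro member_le_sum) auto
          then show "real k / \<delta> \<le> (\<Sum>i\<in>{1..k}. ?W c i)" using i(2) by linarith
        qed (use \<epsilon> in simp)
        also have "\<dots> \<le> \<Phi> c" using \<epsilon> by (simp add: \<Phi>_def)
        finally show ?thesis using tail_le_1 order_trans by blast
      next
        case False
        \<comment> \<open>The constant 25 reproduces itself: its square root 5 enters the radius,
          and the next threshold is at most 5 times the radius.\<close>
        have "(radius ?N)\<^sup>2 = (real k * L) * real ?N" by (simp add: radius_square)
        also have "\<dots> \<le> (real k * L) * (25 * 2 ^ 2 ^ Suc j * (real k * L))"
          using Suc.prems(2) kL_pos by (intro mult_left_mono) auto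
        also have "\<dots> = (5 * 2 ^ 2 ^ j * (real k * L))\<^sup>2"
          by (simp add: power2_eq_square power_add mult_2)
        finally have radius: "radius ?N \<le> 5 * 2 ^ 2 ^ j * (real k * L)"
          by (rule power2_le_imp_le) (use L_pos in simp)
        have "real (threshold S') = real ?N - ?n" using S'(3,4) by linarith
        also have "\<dots> \<le> dyn_const * radius ?N + 5 / 2 * radius ?N"
          using False by (simp add: dyn_target_radius tilt_mult_N[OF big])
        also have "\<dots> \<le> 21 / 10 * radius ?N + 5 / 2 * radius ?N"
          using dyn_const_le radius_nonneg by (intro add_right_mono mult_right_mono)
        also have "\<dots> \<le> 5 * radius ?N" using radius_nonneg[of ?N] by simp
        also have "\<dots> \<le> 25 * 2 ^ 2 ^ j * (real k * L)" using radius by linarith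
        finally have "tail b (start_DynSlk k \<delta> \<mu> S') n \<le> \<epsilon> * real j"
          using Suc.IH[of S'] S' Suc.prems(3) by simp
        then show ?thesis using \<Phi>_ge(1)[of c] by linarith
      qed
      then show "tail b (if DynSlk = CMY then start_CMY k S' else start_DynSlk k \<delta> \<mu> S') n \<le> \<Phi> c"
        by simp
    qed (use Suc.prems \<Phi>_ge in auto)
    also have "\<Phi> (\<lambda>_. 0) = \<epsilon> * real (Suc j)"
      using k by (simp add: \<Phi>_def martingale_def[OF big] algebra_simps)
    finally show "tail b (start_slack_round k DynSlk (\<lambda>i. \<mu> i * dyn_target k \<delta> ?N) (dyn_slack ?N) S) n
        \<le> \<epsilon> * real (Suc j)" .
  next
    assume "real (threshold S) \<le> 2 * dyn_const\<^sup>2 * real k * L"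
    then have "tail b (start_CMY k S) n \<le> 0"
      using Suc.prems by (intro tail_start_CMY_from_DynSlk) auto
    then show "tail b (start_CMY k S) n \<le> \<epsilon> * real (Suc j)"
      using \<open>0 \<le> \<epsilon> * real (Suc j)\<close> by linarith
  qed (use Suc.prems \<open>0 \<le> \<epsilon> * real (Suc j)\<close> in auto)
qed

end

section \<open>Assembling the bounds on rounds and messages\<close>

lemma DynSlk_whp:
  assumes N: "0 < N"
  defines "B \<equiv> loglog (real N / (real k * L)) + loglog (real k / \<delta>)"
  shows "measure_pmf.prob (arrivals k \<mu> N)
      {xs. real (rounds (run k \<delta> \<mu> N xs)) \<le> 52 * B \<and>
           real (messages (run k \<delta> \<mu> N xs)) \<le> 208 * (real k * B)}
    \<ge> 1 - \<delta> * (4 * loglog (real N))" (is "measure ?P ?good \<ge> _")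
proof -
  obtain J :: nat where J: "real N / (real k * L) \<le> 2 ^ 2 ^ J"
    "real J \<le> 4 * loglog (real N / (real k * L))"
    by (rule loglog_levels)
  obtain Jc :: nat where Jc: "9 * L < 4 * (4 / 3) ^ Jc" "real Jc \<le> 9 * loglog (real k / \<delta>)"
    by (rule CMY_levels[OF kd(1)])
  \<comment> \<open>43 is the 42 of \<open>tail_start_DynSlk\<close> plus one for its strict
    inequality; the initial state has 0 rounds.\<close>
  define b where "b = J + 43 + Jc"
  let ?S = "start_DynSlk k \<delta> \<mu> (init_state N)"
  have "real N \<le> 2 ^ 2 ^ J * (real k * L)" using J(1) kL_pos by (simp add: pos_divide_le_eq)
  also have "\<dots> \<le> 25 * 2 ^ 2 ^ J * (real k * L)" using kL_pos by (intro mult_right_mono) auto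
  finally have "tail b ?S N \<le> (if k = 1 then 0 else \<delta>) * real J"
    by (intro tail_start_DynSlk[OF Jc(1)]) (simp_all add: init_state_def b_def)
  \<comment> \<open>Passing from \<open>N / (k * L)\<close> to \<open>N\<close> needs
    \<open>k * L \<ge> 1\<close>, which is available for \<open>k \<ge> 2\<close>; for
    \<open>k = 1\<close> the failure term is 0.\<close>
  also have "\<dots> \<le> \<delta> * (4 * loglog (real N))"
  proof (cases "k = 1")
    case True
    then show ?thesis using \<delta> loglog_ge_1[of "real N"] by simp
  next
    case False
    have "1 \<le> real k * L"
    proof -
      have "2 * (2 / 3) \<le> real k * L" using L_ge[OF False] k False by (intro mult_mono) auto
      then show ?thesis by simp
    qed
    then have "real N / (real k * L) \<le> real N / 1" by (intro divide_left_mono) auto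
    then have "loglog (real N / (real k * L)) \<le> loglog (real N)" by (intro loglog_mono) simp
    then show ?thesis using J(2) \<delta> False by simp
  qed
  finally have tail: "tail b ?S N \<le> \<delta> * (4 * loglog (real N))" .
  \<comment> \<open>52 is 9 + 43, the constant 43 being absorbed by a \<open>loglog\<close> that is
    at least 1.\<close>
  have b: "real b \<le> 52 * B"
    using J(2) Jc(2) loglog_ge_1[of "real N / (real k * L)"] loglog_ge_1[of "real k / \<delta>"]
    by (simp add: b_def B_def)
  have good: "xs \<in> ?good" if xs: "xs \<in> set_pmf (arrivals k \<mu> N)" "\<not> b < rounds (run k \<delta> \<mu> N xs)" for xs
  proof -
    have "set xs \<subseteq> {1..k}"
      using xs(1) set_item_pmf[OF \<mu>] by (auto simp: arrivals_def set_replicate_pmf)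
    then have "messages (run k \<delta> \<mu> N xs) \<le> 4 * k * rounds (run k \<delta> \<mu> N xs)"
      by (rule messages_run_le[OF k N])
    then have "real (messages (run k \<delta> \<mu> N xs)) \<le> real (4 * k * rounds (run k \<delta> \<mu> N xs))"
      by (subst of_nat_le_iff)
    also have "\<dots> = 4 * real k * real (rounds (run k \<delta> \<mu> N xs))" by simp
    also have "\<dots> \<le> 4 * real k * (52 * B)" using xs(2) b by (intro mult_left_mono) auto
    finally show ?thesis using xs(2) b by simp
  qed
  have "1 - tail b ?S N = measure ?P (- {xs. b < rounds (run k \<delta> \<mu> N xs)})"
    by (simp add: tail_def run_def arrivals_def measure_pmf.prob_compl[symmetric] Compl_eq_Diff_UNIV)
  \<comment> \<open>The message bound needs all entries of \<open>xs\<close> to be players, which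
    holds on the support.\<close>
  also have "\<dots> = measure ?P (- {xs. b < rounds (run k \<delta> \<mu> N xs)} \<inter> set_pmf (arrivals k \<mu> N))"
    by (simp add: measure_Int_set_pmf)
  also have "\<dots> \<le> measure ?P ?good"
    by (rule measure_pmf.finite_measure_mono) (use good in auto)
  finally show ?thesis using tail by linarith
qed

end

theorem theorem4p7:
  "\<exists>C\<^sub>p C\<^sub>r C\<^sub>m :: real. 0 < C\<^sub>p \<and> 0 < C\<^sub>r \<and> 0 < C\<^sub>m \<and>
    (\<forall>(k :: nat) (N :: nat) (\<delta> :: real) (\<mu> :: nat \<Rightarrow> real).
      0 < k \<longrightarrow> 0 < N \<longrightarrow> 0 < \<delta> \<longrightarrow> \<delta> < 1 \<longrightarrow> prob_vector k \<mu> \<longrightarrow>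
      measure_pmf.prob (arrivals k \<mu> N)
        {xs. real (rounds (run k \<delta> \<mu> N xs))
               \<le> C\<^sub>r * (loglog (real N / (real k * ln (real k / \<delta>))) + loglog (real k / \<delta>)) \<and>
             real (messages (run k \<delta> \<mu> N xs))
               \<le> C\<^sub>m * (real k * loglog (real N / (real k * ln (real k / \<delta>)))
                        + real k * loglog (real k / \<delta>))}
        \<ge> 1 - \<delta> * (C\<^sub>p * loglog (real N)))"
proof (rule exI[of _ 4], rule exI[of _ 52], rule exI[of _ 208], intro conjI allI impI)
  fix k N :: nat and \<delta> :: real and \<mu> :: "nat \<Rightarrow> real"
  assume "0 < k" and N: "0 < N" and "0 < \<delta>" "\<delta> < 1" "prob_vector k \<mu>"
  then interpret tracking k \<delta> \<mu> by unfold_locales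
  show "measure_pmf.prob (arrivals k \<mu> N)
      {xs. real (rounds (run k \<delta> \<mu> N xs))
             \<le> 52 * (loglog (real N / (real k * ln (real k / \<delta>))) + loglog (real k / \<delta>)) \<and>
           real (messages (run k \<delta> \<mu> N xs))
             \<le> 208 * (real k * loglog (real N / (real k * ln (real k / \<delta>)))
                      + real k * loglog (real k / \<delta>))}
      \<ge> 1 - \<delta> * (4 * loglog (real N))"
    using DynSlk_whp[OF N] by (simp add: distrib_left)
qed simp_all

end
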